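(* Suppose $f:\mathbb{R}^n\to\mathbb{R}$ is twice continuously differentiable, satisfies the concordant second-order Lipschitz condition with constant $\beta>0$, and attains its minimum; let $x^*$ be its minimal Euclidean-norm minimizer. For any given $\epsilon>0$, let $\mathcal{K}_\psi$ be the total number of generalized homogeneous models needed in the homotopy HSODM to return an approximate global minimum (a point $x$ with $\|\nabla f(x)\|\le\epsilon$). Then $$\mathcal{K}_\psi=\left\lceil2\log_\tau\left(\frac{(1+3(\beta+1))\epsilon}{2(\beta+1)(1+\|\nabla f(0)\|^2)((3\beta+4)\|x^*\|+2)}\right)\right\rceil,$$ where $$\tau=\frac{3(\beta+1)\left(1+\frac{1}{1+3(\beta+1)}+\|x^*\|\right)}{1+3(\beta+1)\left(1+\frac{1}{1+3(\beta+1)}+\|x^*\|\right)}\in(0,1).$$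
   Context: Concordant second-order Lipschitz condition: there is a constant $\beta>0$ such that for any $x\in\operatorname{dom}(f)$, $\|\nabla f(x+d)-\nabla f(x)-\nabla^2f(x)d\|\le\beta\,d^T\nabla^2f(x)d$, where $d$ satisfies $\|d\|\le C$ for some $C>0$ and $x+d\in\operatorname{dom}(f)$. (Such $f$ is convex.) Homotopy HSODM. Notation $g_{k,j}=\nabla f(x_{k,j})$, $H_{k,j}=\nabla^2f(x_{k,j})$. Initialize $x_{0,0}=0$, $\mu_0=2(\beta+1)(1+\|g_{0,0}\|^2)$. For $k=0,1,\dots,K$: run the inner procedure from $x_{k,0}$ with $\mu_k$, obtaining $(x_{k,j},\rho_k)$; set $\mu_{k+1}=\rho_k\mu_k$ and $x_{k+1,0}=x_{k,j}$. Output $x_{K+1,0}$. Inner procedure: for $j=0,1,\dots$: if $\|g_{k,j}+\mu_kx_{k,j}\|\le\frac{\mu_k}{1+3(\beta+1)}$ (approximate centering condition), return $x_{k,j}$ and $\rho_k=\frac{3(\beta+1)(1+\|x_{k,j}\|)}{1+3(\beta+1)(1+\|x_{k,j}\|)}$; otherwise solve the generalized homogeneous model $$\min_{\|[v;t]\|\le1}\begin{bmatrix}v\\t\end{bmatrix}^T\begin{bmatrix}H_{k,j}&g_{k,j}+\mu_kx_{k,j}\\(g_{k,j}+\mu_kx_{k,j})^T&-\mu_k\end{bmatrix}\begin{bmatrix}v\\t\end{bmatrix}$$ with solution $[v_{k,j};t_{k,j}]$ and set $x_{k,j+1}=x_{k,j}+v_{k,j}/t_{k,j}$.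
   Formalization: The equality for the number of models is replaced by an upper bound, with the ceiling read as 0 when negative: for f = 0 no model is ever solved, so the count is 0 while the formula is positive for small ε. *)

theory Defs
  imports "HOL-Analysis.Analysis"
begin

definition gradient :: "(real^'n \<Rightarrow> real) \<Rightarrow> real^'n \<Rightarrow> real^'n" where
  "gradient f x = (THE g. GDERIV f x :> g)"

definition hessian :: "(real^'n \<Rightarrow> real) \<Rightarrow> real^'n \<Rightarrow> real^'n^'n" where
  "hessian f x = jacobian (gradient f) (at x)"

definition twice_continuously_differentiable :: "(real^'n \<Rightarrow> real) \<Rightarrow> bool" where
  "twice_continuously_differentiable f \<longleftrightarrow>
     (\<forall>x. f differentiable at x) \<and> (\<forall>x. gradient f differentiable at x) \<and>
     continuous_on UNIV (hessian f)"

text \<open>The radius \<open>C\<close> is uniform in \<open>x\<close>; it does not enter the algorithm or the bound.\<close>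

definition concordant_lipschitz :: "(real^'n \<Rightarrow> real) \<Rightarrow> real \<Rightarrow> bool" where
  "concordant_lipschitz f \<beta> \<longleftrightarrow> \<beta> > 0 \<and>
     (\<exists>C>0. \<forall>x d. norm d \<le> C \<longrightarrow>
        norm (gradient f (x + d) - gradient f x - hessian f x *v d)
          \<le> \<beta> * (d \<bullet> (hessian f x *v d)))"

definition min_norm_minimizer :: "(real^'n \<Rightarrow> real) \<Rightarrow> real^'n" where
  "min_norm_minimizer f = (ARG_MIN norm x. is_arg_min f (\<lambda>_. True) x)"

text \<open>The action of the block matrix \<open>[H, p; p\<^sup>T, -\<mu>]\<close> on \<open>[v; t]\<close>. The product type carries the
  Euclidean inner product and norm of \<open>\<real>\<^sup>n\<^sup>+\<^sup>1\<close>.\<close>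

definition ghm_op ::
  "real^'n^'n \<Rightarrow> real^'n \<Rightarrow> real \<Rightarrow> (real^'n) \<times> real \<Rightarrow> (real^'n) \<times> real" where
  "ghm_op H p \<mu> = (\<lambda>(v, t). (H *v v + t *\<^sub>R p, p \<bullet> v - \<mu> * t))"

definition ghm_solution ::
  "real^'n^'n \<Rightarrow> real^'n \<Rightarrow> real \<Rightarrow> (real^'n) \<times> real \<Rightarrow> bool" where
  "ghm_solution H p \<mu> = is_arg_min (\<lambda>z. z \<bullet> ghm_op H p \<mu> z) (\<lambda>z. norm z \<le> 1)"

text \<open>A solver maps the data \<open>H\<close>, \<open>p\<close>, \<open>\<mu>\<close> of a model to a vector \<open>[v; t]\<close>. Models need not have
  a unique solution, so the algorithm is parametrised by a family of solvers: \<open>S k j\<close> is used at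
  inner iteration \<open>j\<close> of outer iteration \<open>k\<close>.\<close>

type_synonym 'n solver = "real^'n^'n \<Rightarrow> real^'n \<Rightarrow> real \<Rightarrow> (real^'n) \<times> real"

definition model_solution :: "'n solver \<Rightarrow> (real^'n \<Rightarrow> real) \<Rightarrow> real \<Rightarrow> real^'n \<Rightarrow> (real^'n) \<times> real" where
  "model_solution s f \<mu> x = s (hessian f x) (gradient f x + \<mu> *\<^sub>R x) \<mu>"

text \<open>The sequence is continued beyond the index at which the inner procedure returns; that index
  is \<open>inner_count\<close> below, and the later entries are never used. Since \<open>LEAST\<close> is unspecified
  when no index qualifies, statements about \<open>inner_count\<close> are meaningful only together with
  termination of the inner procedure.\<close>

primrec inner_iterate ::
  "(nat \<Rightarrow> 'n solver) \<Rightarrow> (real^'n \<Rightarrow> real) \<Rightarrow> real \<Rightarrow> real^'n \<Rightarrow> nat \<Rightarrow> real^'n" where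
  "inner_iterate s f \<mu> x 0 = x"
| "inner_iterate s f \<mu> x (Suc j) =
     (let y = inner_iterate s f \<mu> x j; (v, t) = model_solution (s j) f \<mu> y
      in y + v /\<^sub>R t)"

definition approx_centered :: "(real^'n \<Rightarrow> real) \<Rightarrow> real \<Rightarrow> real \<Rightarrow> real^'n \<Rightarrow> bool" where
  "approx_centered f \<beta> \<mu> x \<longleftrightarrow> norm (gradient f x + \<mu> *\<^sub>R x) \<le> \<mu> / (1 + 3 * (\<beta> + 1))"

definition inner_count ::
  "(nat \<Rightarrow> 'n solver) \<Rightarrow> (real^'n \<Rightarrow> real) \<Rightarrow> real \<Rightarrow> real \<Rightarrow> real^'n \<Rightarrow> nat" where
  "inner_count s f \<beta> \<mu> x = (LEAST j. approx_centered f \<beta> \<mu> (inner_iterate s f \<mu> x j))"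

definition shrink_factor :: "real \<Rightarrow> real^'n \<Rightarrow> real" where
  "shrink_factor \<beta> x = 3 * (\<beta> + 1) * (1 + norm x) / (1 + 3 * (\<beta> + 1) * (1 + norm x))"

text \<open>\<open>hsodm_state S f \<beta> k\<close> is the pair of \<open>x\<^bsub>k,0\<^esub>\<close> and \<open>\<mu>\<^sub>k\<close>.\<close>

primrec hsodm_state ::
  "(nat \<Rightarrow> nat \<Rightarrow> 'n solver) \<Rightarrow> (real^'n \<Rightarrow> real) \<Rightarrow> real \<Rightarrow> nat \<Rightarrow> (real^'n) \<times> real" where
  "hsodm_state S f \<beta> 0 = (0, 2 * (\<beta> + 1) * (1 + (norm (gradient f 0))\<^sup>2))"
| "hsodm_state S f \<beta> (Suc k) =
     (let (x, \<mu>) = hsodm_state S f \<beta> k;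
          y = inner_iterate (S k) f \<mu> x (inner_count (S k) f \<beta> \<mu> x)
      in (y, shrink_factor \<beta> y * \<mu>))"

definition hsodm_mu ::
  "(nat \<Rightarrow> nat \<Rightarrow> 'n solver) \<Rightarrow> (real^'n \<Rightarrow> real) \<Rightarrow> real \<Rightarrow> nat \<Rightarrow> real" where
  "hsodm_mu S f \<beta> k = snd (hsodm_state S f \<beta> k)"

definition hsodm_iterate ::
  "(nat \<Rightarrow> nat \<Rightarrow> 'n solver) \<Rightarrow> (real^'n \<Rightarrow> real) \<Rightarrow> real \<Rightarrow> nat \<Rightarrow> nat \<Rightarrow> real^'n" where
  "hsodm_iterate S f \<beta> k j =
     inner_iterate (S k) f (hsodm_mu S f \<beta> k) (fst (hsodm_state S f \<beta> k)) j"

definition hsodm_inner_count ::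
  "(nat \<Rightarrow> nat \<Rightarrow> 'n solver) \<Rightarrow> (real^'n \<Rightarrow> real) \<Rightarrow> real \<Rightarrow> nat \<Rightarrow> nat" where
  "hsodm_inner_count S f \<beta> k =
     inner_count (S k) f \<beta> (hsodm_mu S f \<beta> k) (fst (hsodm_state S f \<beta> k))"

text \<open>Every inner procedure returns, and every model solved before it returns has \<open>t \<noteq> 0\<close>.\<close>

definition hsodm_well_defined ::
  "(nat \<Rightarrow> nat \<Rightarrow> 'n solver) \<Rightarrow> (real^'n \<Rightarrow> real) \<Rightarrow> real \<Rightarrow> bool" where
  "hsodm_well_defined S f \<beta> \<longleftrightarrow>
     (\<forall>k. (\<exists>j. approx_centered f \<beta> (hsodm_mu S f \<beta> k) (hsodm_iterate S f \<beta> k j)) \<and>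
          (\<forall>j < hsodm_inner_count S f \<beta> k.
             snd (model_solution (S k j) f (hsodm_mu S f \<beta> k) (hsodm_iterate S f \<beta> k j)) \<noteq> 0))"

definition hsodm_output ::
  "(nat \<Rightarrow> nat \<Rightarrow> 'n solver) \<Rightarrow> (real^'n \<Rightarrow> real) \<Rightarrow> real \<Rightarrow> nat \<Rightarrow> real^'n" where
  "hsodm_output S f \<beta> K = hsodm_iterate S f \<beta> (K + 1) 0"

text \<open>The number of models solved by the shortest run (smallest \<open>K\<close>) whose output has gradient norm
  at most \<open>\<epsilon>\<close>; meaningful only if such a \<open>K\<close> exists.\<close>

definition hsodm_models_needed ::
  "(nat \<Rightarrow> nat \<Rightarrow> 'n solver) \<Rightarrow> (real^'n \<Rightarrow> real) \<Rightarrow> real \<Rightarrow> real \<Rightarrow> nat" where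
  "hsodm_models_needed S f \<beta> \<epsilon> =
     (\<Sum>k \<le> (LEAST K. norm (gradient f (hsodm_output S f \<beta> K)) \<le> \<epsilon>). hsodm_inner_count S f \<beta> k)"

end

theory Submission
  imports Defs
begin

text \<open>
Write \<open>R = restart_residual \<beta>\<close>, and measure how far a point \<open>x\<close> is from the minimizer of
\<open>f + \<mu>/2 \<parallel>\<cdot>\<parallel>\<^sup>2\<close> by the residual \<open>\<parallel>\<nabla>f(x) + \<mu>x\<parallel>\<close>. The bound holds because an outer iteration never
needs more than one model.

A solution \<open>[v; t]\<close> of a model is an eigenvector of the block matrix for its least eigenvalue \<open>-\<delta>\<close>.
Since the Hessian \<open>H\<close> is positive semidefinite, \<open>\<delta> \<ge> \<mu>\<close> and \<open>t \<noteq> 0\<close>, and \<open>d = v/t\<close> is a regularized Newton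
step: \<open>(H + \<delta>)d = -p\<close> and \<open>p \<bullet> d = \<mu> - \<delta>\<close> with \<open>p = \<nabla>f(x) + \<mu>x\<close> (\<open>ghm_solution_step\<close>; the block matrix is
symmetric by \<open>second_derivative_symmetric\<close>). The new residual
vector is therefore \<open>(\<mu> - \<delta>)d\<close> plus the Taylor remainder of the gradient. Both are quadratically small:
from \<open>\<parallel>p\<parallel> \<le> s\<mu>\<close> follows a new residual of at most \<open>s\<^sup>2(s + \<beta>/2)\<mu>\<close> (\<open>homogeneous_step_contraction\<close>).
Shrinking \<open>\<mu>\<close> by \<open>\<rho>\<close> turns an approximately centered point into one of relative residual at most \<open>R\<close>,
and \<open>R\<^sup>2(R + \<beta>/2) \<le> 1/(1 + 3(\<beta>+1))\<close>, so that a single step restores approximate centering. The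
starting point is approximately centered already, by the size of \<open>\<mu>\<^sub>0\<close>; hence the outer iterations
\<open>0, \<dots>, K\<close> solve at most \<open>K\<close> models together.

The delicate point is the Taylor remainder. Concordance bounds it only for \<open>\<parallel>d\<parallel> \<le> C\<close>, while \<open>C\<close> may be far
smaller than the steps taken, whose length is only bounded by \<open>R\<close>. Adding the concordance inequalities
for the two directions of a short segment gives a discrete differential inequality for the Hessian
along a line, and Gronwall's argument gives exponential growth at rate \<open>2\<beta>\<close>
(\<open>derivative_change_exponential\<close>). Integrated, this bounds the remainder by \<open>2\<beta> d\<^sup>THd\<close> for all steps with
\<open>2\<beta>\<parallel>d\<parallel> \<le> 4/3\<close> (\<open>concordance_long_step\<close>), and \<open>2\<beta>R \<le> 4/3\<close>. The doubled constant is harmless because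
\<open>d\<^sup>THd \<le> \<mu>\<parallel>d\<parallel>(s - \<parallel>d\<parallel>) \<le> s\<^sup>2\<mu>/4\<close>: a step cannot be long and meet much curvature at once.

Finally, monotonicity of the gradient keeps every returned point within norm
\<open>\<parallel>x\<^sup>*\<parallel> + 1/(1 + 3(\<beta>+1))\<close>. So every shrink factor is at most \<open>\<tau>\<close>, and the gradient at the output is at
most \<open>\<mu>\<^sub>K (\<parallel>x\<^sup>*\<parallel> + 2/(1 + 3(\<beta>+1)))\<close> with \<open>\<mu>\<^sub>K \<le> \<tau>\<^sup>K \<mu>\<^sub>0\<close>. This is at most \<open>\<epsilon>\<close> once \<open>K\<close> reaches the
logarithm in the theorem without its factor \<open>2\<close>.
\<close>

section \<open>Symmetry of the second derivative\<close>

text \<open>The second difference of \<open>f\<close> is a symmetric function of \<open>u\<close> and \<open>v\<close>, and this lemma says that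
it approximates the bilinear form \<open>A u \<bullet> v\<close>. It is the increment over \<open>[0, 1]\<close> of
\<open>s \<mapsto> f (x + u + s v) - f (x + s v)\<close>; by the mean value theorem that is a difference of two gradients,
to which the linearization of \<open>G\<close> at \<open>x\<close> applies.\<close>

lemma second_difference_estimate:
  fixes f :: "'a::real_inner \<Rightarrow> real"
  assumes grad: "\<And>y. GDERIV f y :> G y"
    and lin: "linear A"
    and near: "\<And>w. norm w \<le> norm u + norm v \<Longrightarrow>
        norm (G (x + w) - G x - A w) \<le> e * norm w"
    and e: "0 \<le> e"
  shows "\<bar>f (x + u + v) - f (x + u) - f (x + v) + f x - A u \<bullet> v\<bar>
           \<le> 2 * e * (norm u + norm v)\<^sup>2"
proof -
  define \<phi> where "\<phi> s = f (x + u + s *\<^sub>R v) - f (x + s *\<^sub>R v)" for s :: real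
  have d: "((\<lambda>s. f (y + s *\<^sub>R v)) has_derivative (\<lambda>h. h * (v \<bullet> G (y + s *\<^sub>R v)))) (at s within S)"
    for y s S
  proof -
    have "(f has_derivative (\<lambda>h. h \<bullet> G (y + s *\<^sub>R v))) (at (y + s *\<^sub>R v))"
      using grad by (simp add: gderiv_def)
    moreover have "((\<lambda>s. y + s *\<^sub>R v) has_derivative (\<lambda>h. h *\<^sub>R v)) (at s within S)"
      by (auto intro!: derivative_eq_intros)
    ultimately show ?thesis
      by (auto dest: has_derivative_compose)
  qed
  have "(\<phi> has_derivative (\<lambda>h. h * (v \<bullet> G (x + u + s *\<^sub>R v)) - h * (v \<bullet> G (x + s *\<^sub>R v))))
      (at s within {0..1})" for s
    unfolding \<phi>_def by (intro has_derivative_diff d)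
  from mvt_simple[of 0 1 \<phi>, OF _ this] obtain s where s: "0 < s" "s < 1"
    and eq: "\<phi> 1 - \<phi> 0 = v \<bullet> G (x + u + s *\<^sub>R v) - v \<bullet> G (x + s *\<^sub>R v)"
    by auto
  let ?N = "norm u + norm v"
  have nsv: "norm (s *\<^sub>R v) \<le> norm v"
    using s by (simp add: mult_left_le_one_le)
  have n1: "norm (u + s *\<^sub>R v) \<le> ?N"
    using norm_triangle_ineq[of u "s *\<^sub>R v"] nsv by linarith
  have n2: "norm (s *\<^sub>R v) \<le> ?N"
    using nsv norm_ge_zero[of u] by linarith
  define r1 where "r1 = G (x + (u + s *\<^sub>R v)) - G x - A (u + s *\<^sub>R v)"
  define r2 where "r2 = G (x + s *\<^sub>R v) - G x - A (s *\<^sub>R v)"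
  have "norm r1 \<le> e * ?N" "norm r2 \<le> e * ?N"
    unfolding r1_def r2_def
    by (meson near n1 n2 e mult_left_mono order_trans)+
  then have r: "norm (r1 - r2) \<le> 2 * e * ?N"
    using norm_triangle_ineq4[of r1 r2] by linarith
  have "G (x + u + s *\<^sub>R v) - G (x + s *\<^sub>R v) = A u + (r1 - r2)"
    by (simp add: r1_def r2_def linear_add[OF lin] add.assoc)
  then have "\<phi> 1 - \<phi> 0 - A u \<bullet> v = v \<bullet> (r1 - r2)"
    unfolding eq inner_diff_right[symmetric] by (simp add: inner_add_right inner_commute)
  then have "\<bar>\<phi> 1 - \<phi> 0 - A u \<bullet> v\<bar> \<le> norm v * norm (r1 - r2)"
    using Cauchy_Schwarz_ineq2 by metis
  also have "\<dots> \<le> ?N * (2 * e * ?N)"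
    using r by (intro mult_mono) auto
  finally show ?thesis
    by (simp add: \<phi>_def power2_eq_square algebra_simps)
qed

text \<open>Scale \<open>u\<close> and \<open>v\<close> by \<open>t\<close>: the second difference differs from both \<open>t\<^sup>2 (A u \<bullet> v)\<close> and
\<open>t\<^sup>2 (A v \<bullet> u)\<close> by \<open>o(t\<^sup>2)\<close>.\<close>

lemma second_derivative_symmetric:
  fixes f :: "'a::real_inner \<Rightarrow> real"
  assumes grad: "\<And>y. GDERIV f y :> G y"
    and der: "(G has_derivative A) (at x)"
  shows "A u \<bullet> v = A v \<bullet> u"
proof (rule ccontr)
  assume ne: "A u \<bullet> v \<noteq> A v \<bullet> u"
  let ?g = "\<bar>A u \<bullet> v - A v \<bullet> u\<bar>"
  let ?N = "norm u + norm v"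
  have lin: "linear A"
    using der by (rule has_derivative_linear)
  have "u \<noteq> 0 \<or> v \<noteq> 0"
    using ne by auto
  then have N: "0 < ?N"
    by (auto simp: add_pos_nonneg add_nonneg_pos)
  \<comment> \<open>The two estimates together cost \<open>4 e N\<^sup>2\<close>, which must stay below the gap \<open>g\<close>.\<close>
  define e where "e = ?g / (5 * ?N\<^sup>2)"
  have e: "0 < e" using ne N by (simp add: e_def)
  then obtain \<delta> where \<delta>: "0 < \<delta>"
    and near: "\<And>y. norm (y - x) < \<delta> \<Longrightarrow> norm (G y - G x - A (y - x)) \<le> e * norm (y - x)"
    using der unfolding has_derivative_at_alt by blast
  define t where "t = \<delta> / (2 * ?N)"
  have t: "0 < t" using \<delta> N by (simp add: t_def)
  have scale: "norm (t *\<^sub>R u) + norm (t *\<^sub>R v) = t * ?N"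
    using t by (simp add: distrib_left)
  have "\<delta> / (2 * M) * M < \<delta>" if "0 < M" for M
    using that \<delta> by simp
  from this[OF N] have small: "t * ?N < \<delta>"
    unfolding t_def .
  have est: "\<bar>f (x + a + b) - f (x + a) - f (x + b) + f x - A a \<bullet> b\<bar> \<le> 2 * e * (t * ?N)\<^sup>2"
    if "norm a + norm b = t * ?N" for a b
    using second_difference_estimate[OF grad lin, of a b x e] near[of "x + _"] small e that
    by fastforce
  have "\<bar>A (t *\<^sub>R u) \<bullet> (t *\<^sub>R v) - A (t *\<^sub>R v) \<bullet> (t *\<^sub>R u)\<bar> \<le> 4 * e * (t * ?N)\<^sup>2"
    using est[of "t *\<^sub>R u" "t *\<^sub>R v"] est[of "t *\<^sub>R v" "t *\<^sub>R u"] scale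
    by (simp add: add_ac)
  moreover have "A (t *\<^sub>R u) \<bullet> (t *\<^sub>R v) - A (t *\<^sub>R v) \<bullet> (t *\<^sub>R u) = t\<^sup>2 * (A u \<bullet> v - A v \<bullet> u)"
    by (simp add: linear_cmul[OF lin] power2_eq_square algebra_simps)
  ultimately have "t\<^sup>2 * ?g \<le> 4 * e * (t\<^sup>2 * ?N\<^sup>2)"
    by (simp only: abs_mult abs_power2 power_mult_distrib)
  then have "t\<^sup>2 * ?g \<le> t\<^sup>2 * (4 * e * ?N\<^sup>2)"
    by (simp only: mult_ac)
  then have "?g \<le> 4 * e * ?N\<^sup>2"
    using t by simp
  also have "\<dots> = 4 / 5 * ?g"
    using N by (simp add: e_def)
  finally show False
    using ne by simp
qed

section \<open>Concordant vector fields\<close>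

text \<open>The steps of the algorithm are bounded by \<open>R = restart_residual \<beta>\<close>, defined below, and \<open>4/3\<close> is the
supremum of \<open>2\<beta>R\<close> over all \<open>\<beta>\<close>.\<close>

lemma exp_le_quadratic:
  fixes y :: real
  assumes "0 \<le> y" "y \<le> 4 / 3"
  shows "exp y \<le> 1 + y + y\<^sup>2"
proof (cases "y \<le> 1")
  case True
  then show ?thesis using exp_bound[of y] assms by simp
next
  case False
  define u where "u = y - 1"
  have u: "0 \<le> u" "u \<le> 1 / 3"
    using False assms by (auto simp: u_def)
  have "exp y = exp 1 * exp u"
    by (simp add: u_def flip: exp_add)
  also have "\<dots> \<le> 272 / 100 * (1 + u + u\<^sup>2)"
    using e_less_272 exp_bound[of u] u by (intro mult_mono) auto
  also have "\<dots> \<le> 3 + 3 * u + u\<^sup>2"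
  proof -
    have "u * u \<le> 1 / 3 * (1 / 3)"
      using u by (intro mult_mono) auto
    then show ?thesis
      using u by (simp add: power2_eq_square)
  qed
  also have "\<dots> = 1 + y + y\<^sup>2"
    by (simp add: u_def power2_eq_square algebra_simps)
  finally show ?thesis .
qed

text \<open>The concordance condition for a vector field \<open>G\<close> (the gradient) and its derivative \<open>H\<close>. Besides
it, only the symmetry of \<open>H\<close> and the existence of a minimizer enter the analysis of the algorithm.\<close>

locale concordant_field =
  fixes G :: "'a::real_inner \<Rightarrow> 'a" and H :: "'a \<Rightarrow> 'a \<Rightarrow> 'a" and \<beta> C :: real
  assumes field_derivative: "(G has_derivative H x) (at x)"
    and beta_pos: "0 < \<beta>"
    and radius_pos: "0 < C"
    and concordance: "norm d \<le> C \<Longrightarrow> norm (G (x + d) - G x - H x d) \<le> \<beta> * (d \<bullet> H x d)"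
begin

lemma linear_H: "linear (H x)"
  using field_derivative by (rule has_derivative_linear)

lemma H_scaleR: "H x (c *\<^sub>R d) = c *\<^sub>R H x d"
  by (rule linear_cmul[OF linear_H])

text \<open>A norm is nonnegative, so concordance forces this for short \<open>d\<close>, and the quadratic form is
homogeneous.\<close>

lemma H_psd: "0 \<le> d \<bullet> H x d"
proof (cases "d = 0")
  case False
  define c where "c = C / norm d"
  have c: "0 < c" using False radius_pos by (simp add: c_def)
  have "norm (c *\<^sub>R d) \<le> C"
    using False radius_pos by (simp add: c_def)
  from order_trans[OF norm_ge_zero concordance[OF this]]
  have "0 \<le> \<beta> * (c * c * (d \<bullet> H x d))"
    by (simp add: H_scaleR mult.assoc)
  then show ?thesis
    using beta_pos c mult_pos_pos[OF c c] by (simp add: zero_le_mult_iff)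
qed simp

text \<open>Going from \<open>x\<close> to \<open>x + u\<close> and back, the increments of \<open>G\<close> cancel, and only the change of its
derivative is left.\<close>

lemma derivative_change_short_step:
  assumes "norm u \<le> C"
  shows "norm (H (x + u) u - H x u) \<le> \<beta> * (u \<bullet> H (x + u) u + u \<bullet> H x u)"
proof -
  define r1 where "r1 = G (x + u) - G x - H x u"
  define r2 where "r2 = G (x + u + - u) - G (x + u) - H (x + u) (- u)"
  have "norm r1 \<le> \<beta> * (u \<bullet> H x u)"
    unfolding r1_def by (rule concordance[OF assms])
  moreover have "norm r2 \<le> \<beta> * (u \<bullet> H (x + u) u)"
    unfolding r2_def using concordance[of "- u" "x + u"] assms
    by (simp add: linear_neg[OF linear_H])
  moreover have "H (x + u) u - H x u = r1 + r2"
    by (simp add: r1_def r2_def linear_neg[OF linear_H])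
  ultimately show ?thesis
    using norm_triangle_ineq[of r1 r2] by (simp add: distrib_left)
qed

text \<open>Gronwall's argument in discrete form. Cut the segment into \<open>n\<close> equal pieces, each of length at
most \<open>C\<close>. The quantity \<open>a\<close> below dominates the curvature \<open>d \<bullet> H y d\<close>, so the estimate for a short step
bounds its growth over one piece by the factor \<open>(1 + \<sigma>/n) / (1 - \<sigma>/n)\<close>. The \<open>n\<close>-th power of this factor
tends to \<open>exp (2 \<sigma>)\<close>, and \<open>C\<close> disappears in the limit.\<close>

lemma derivative_change_exponential:
  "norm d * norm (H (x + d) d - H x d) \<le> (exp (2 * \<beta> * norm d) - 1) * (d \<bullet> H x d)"
proof -
  define \<sigma> where "\<sigma> = \<beta> * norm d"
  define a where "a y = d \<bullet> H x d + norm d * norm (H y d - H x d)" for y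
  have curvature_le: "d \<bullet> H y d \<le> a y" for y
  proof -
    have "d \<bullet> (H y d - H x d) \<le> norm d * norm (H y d - H x d)"
      by (rule norm_cauchy_schwarz)
    then show ?thesis by (simp add: a_def inner_diff_right)
  qed
  have step: "(1 - \<sigma> / n) * a (y + (1 / n) *\<^sub>R d) \<le> (1 + \<sigma> / n) * a y"
    if n: "0 < n" "norm d / n \<le> C" for n y
  proof -
    let ?u = "(1 / n) *\<^sub>R d"
    let ?y = "y + ?u"
    have "norm (H ?y ?u - H y ?u) \<le> \<beta> * (?u \<bullet> H ?y ?u + ?u \<bullet> H y ?u)"
      using n by (intro derivative_change_short_step) simp
    moreover have "H ?y ?u - H y ?u = (1 / n) *\<^sub>R (H ?y d - H y d)"
      by (simp add: H_scaleR scaleR_diff_right)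
    moreover have "\<beta> * (?u \<bullet> H ?y ?u + ?u \<bullet> H y ?u)
        = 1 / n * (\<beta> / n * (d \<bullet> H ?y d + d \<bullet> H y d))"
      by (simp add: H_scaleR add_divide_distrib distrib_left)
    ultimately have "1 / n * norm (H ?y d - H y d)
        \<le> 1 / n * (\<beta> / n * (d \<bullet> H ?y d + d \<bullet> H y d))"
      using n by simp
    then have "norm (H ?y d - H y d) \<le> \<beta> / n * (d \<bullet> H ?y d + d \<bullet> H y d)"
      by (rule mult_left_le_imp_le) (use n in simp)
    also have "\<dots> \<le> \<beta> / n * (a ?y + a y)"
      using beta_pos n by (intro mult_left_mono add_mono curvature_le) auto
    finally have "norm (H ?y d - H y d) \<le> \<beta> / n * (a ?y + a y)" .
    moreover have "norm (H ?y d - H x d) \<le> norm (H ?y d - H y d) + norm (H y d - H x d)"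
      using norm_triangle_ineq[of "H ?y d - H y d" "H y d - H x d"] by simp
    ultimately have "norm (H ?y d - H x d) \<le> \<beta> / n * (a ?y + a y) + norm (H y d - H x d)"
      by linarith
    then have "norm d * norm (H ?y d - H x d) \<le> norm d * (\<beta> / n * (a ?y + a y) + norm (H y d - H x d))"
      by (rule mult_left_mono) simp
    then have "a ?y \<le> a y + \<sigma> / n * (a ?y + a y)"
      by (simp add: a_def \<sigma>_def algebra_simps)
    then show ?thesis
      by (simp add: algebra_simps)
  qed
  have iter: "(1 - \<sigma> / n) ^ i * a (x + (i / n) *\<^sub>R d) \<le> (1 + \<sigma> / n) ^ i * a x"
    if n: "0 < n" "norm d / n \<le> C" "\<sigma> / n \<le> 1" for n :: real and i :: nat
  proof (induction i)
    case (Suc i)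
    let ?y = "x + (real i / n) *\<^sub>R d"
    have \<sigma>: "0 \<le> \<sigma> / n" using n beta_pos by (simp add: \<sigma>_def)
    have "(1 - \<sigma> / n) ^ Suc i * a (x + (real (Suc i) / n) *\<^sub>R d)
        = (1 - \<sigma> / n) ^ i * ((1 - \<sigma> / n) * a (?y + (1 / n) *\<^sub>R d))"
      by (simp add: scaleR_left_distrib add_divide_distrib add_ac mult_ac)
    also have "\<dots> \<le> (1 - \<sigma> / n) ^ i * ((1 + \<sigma> / n) * a ?y)"
      using n by (intro mult_left_mono step) auto
    also have "\<dots> = (1 + \<sigma> / n) * ((1 - \<sigma> / n) ^ i * a ?y)"
      by simp
    also have "\<dots> \<le> (1 + \<sigma> / n) * ((1 + \<sigma> / n) ^ i * a x)"
      using \<sigma> Suc by (intro mult_left_mono) auto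
    finally show ?case by simp
  qed simp
  have "\<forall>\<^sub>F n in sequentially. max (norm d / C) \<sigma> < real n"
    using filterlim_real_sequentially unfolding filterlim_at_top_dense by blast
  then have ev: "\<forall>\<^sub>F n in sequentially.
      (1 + (- \<sigma>) / real n) ^ n * a (x + d) \<le> (1 + \<sigma> / real n) ^ n * a x"
  proof (rule eventually_mono)
    fix n :: nat
    assume n: "max (norm d / C) \<sigma> < real n"
    moreover have "0 \<le> norm d / C" using radius_pos by simp
    ultimately have pos: "0 < real n" by linarith
    moreover have "norm d / real n \<le> C"
      using n pos radius_pos by (simp add: field_simps)
    ultimately show "(1 + (- \<sigma>) / real n) ^ n * a (x + d) \<le> (1 + \<sigma> / real n) ^ n * a x"
      using iter[of "real n" n] n by simp
  qed
  have "exp (- \<sigma>) * a (x + d) \<le> exp \<sigma> * a x"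
    by (rule tendsto_le[OF sequentially_bot _ _ ev])
      (intro tendsto_mult tendsto_const tendsto_exp_limit_sequentially)+
  then have "exp \<sigma> * (exp (- \<sigma>) * a (x + d)) \<le> exp \<sigma> * (exp \<sigma> * a x)"
    by (intro mult_left_mono) auto
  then have "a (x + d) \<le> exp (2 * \<sigma>) * a x"
    by (simp add: exp_minus_inverse mult.assoc[symmetric] flip: exp_add)
  then show ?thesis
    by (simp add: a_def \<sigma>_def algebra_simps)
qed

text \<open>The derivative of \<open>s \<mapsto> G (x + s d) - s H x d\<close> is the change of \<open>H\<close> along the segment, which the
previous lemma bounds. Integration gives the remainder bound \<open>(exp l - 1 - l) / l\<close> times
\<open>(d \<bullet> H x d) / \<parallel>d\<parallel>\<close> with \<open>l = 2 \<beta> \<parallel>d\<parallel>\<close>, and on the admitted range the exponential is at most quadratic.\<close>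

lemma concordance_long_step:
  assumes short: "2 * \<beta> * norm d \<le> 4 / 3"
  shows "norm (G (x + d) - G x - H x d) \<le> 2 * \<beta> * (d \<bullet> H x d)"
proof (cases "d = 0")
  case True
  then show ?thesis by (simp add: linear_0[OF linear_H])
next
  case False
  define \<psi> where "\<psi> = d \<bullet> H x d"
  define l where "l = 2 * \<beta> * norm d"
  have l: "0 < l" "l \<le> 4 / 3"
    using False beta_pos short by (auto simp: l_def)
  have \<psi>: "0 \<le> \<psi>"
    unfolding \<psi>_def by (rule H_psd)
  define h where "h s = G (x + s *\<^sub>R d) - s *\<^sub>R H x d" for s
  define \<phi> where "\<phi> s = \<psi> / norm d * (exp (l * s) / l - s)" for s
  have h': "(h has_vector_derivative (H (x + s *\<^sub>R d) d - H x d)) (at s)" for s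
  proof -
    have "((\<lambda>s. x + s *\<^sub>R d) has_derivative (\<lambda>c. c *\<^sub>R d)) (at s)"
      by (auto intro!: derivative_eq_intros)
    from has_derivative_compose[OF this field_derivative]
    have "((\<lambda>s. G (x + s *\<^sub>R d)) has_derivative (\<lambda>c. c *\<^sub>R H (x + s *\<^sub>R d) d)) (at s)"
      by (simp add: H_scaleR)
    then show ?thesis
      unfolding h_def has_vector_derivative_def
      by (auto intro!: derivative_eq_intros simp: scaleR_diff_right)
  qed
  have \<phi>': "(\<phi> has_vector_derivative (\<psi> / norm d * (exp (l * s) - 1))) (at s)" for s
    unfolding \<phi>_def has_real_derivative_iff_has_vector_derivative[symmetric]
    using l False by (auto intro!: derivative_eq_intros)
  have "norm (h 1 - h 0) \<le> \<phi> 1 - \<phi> 0"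
  proof (rule differentiable_bound_general[OF _ _ _ h' \<phi>'])
    show "continuous_on {0..1} h" "continuous_on {0..1} \<phi>"
      using h' \<phi>' by (meson continuous_at_imp_continuous_on has_vector_derivative_continuous)+
    fix s :: real
    assume s: "0 < s" "s < 1"
    \<comment> \<open>The growth estimate for the vector \<open>s d\<close> carries a factor \<open>s\<^sup>2\<close> on both sides.\<close>
    have "s * norm d * (s * norm (H (x + s *\<^sub>R d) d - H x d))
        \<le> (exp (2 * \<beta> * (s * norm d)) - 1) * (s * (s * \<psi>))"
      using derivative_change_exponential[of "s *\<^sub>R d" x] s
      by (simp add: H_scaleR \<psi>_def flip: scaleR_diff_right)
    then have "(s * s) * (norm d * norm (H (x + s *\<^sub>R d) d - H x d))
        \<le> (s * s) * ((exp (l * s) - 1) * \<psi>)"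
      by (simp add: l_def mult_ac)
    then have "norm d * norm (H (x + s *\<^sub>R d) d - H x d) \<le> (exp (l * s) - 1) * \<psi>"
      using s by simp
    then show "norm (H (x + s *\<^sub>R d) d - H x d) \<le> \<psi> / norm d * (exp (l * s) - 1)"
      using False by (simp add: field_simps)
  qed simp
  also have "\<phi> 1 - \<phi> 0 = \<psi> / norm d * ((exp l - 1 - l) / l)"
    using l by (simp add: \<phi>_def diff_divide_distrib right_diff_distrib)
  also have "\<dots> \<le> \<psi> / norm d * l"
  proof (rule mult_left_mono)
    show "(exp l - 1 - l) / l \<le> l"
      using exp_le_quadratic[of l] l by (simp add: field_simps power2_eq_square)
  qed (use \<psi> in simp)
  also have "\<dots> = 2 * \<beta> * \<psi>"
    using False by (simp add: l_def)
  finally show ?thesis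
    by (simp add: h_def \<psi>_def diff_diff_eq add.commute)
qed

lemma monotone_field: "0 \<le> (G y - G x) \<bullet> (y - x)"
proof -
  let ?d = "y - x"
  have d: "((\<lambda>s. G (x + s *\<^sub>R ?d) \<bullet> ?d) has_derivative (\<lambda>c. c * (H (x + s *\<^sub>R ?d) ?d \<bullet> ?d)))
      (at s within {0..1})" for s :: real
  proof -
    have "((\<lambda>s. x + s *\<^sub>R ?d) has_derivative (\<lambda>c. c *\<^sub>R ?d)) (at s within {0..1})"
      by (auto intro!: derivative_eq_intros)
    from has_derivative_inner_left[OF has_derivative_compose[OF this field_derivative]]
    show ?thesis by (simp add: H_scaleR)
  qed
  from mvt_simple[of 0 1, OF _ d] obtain s where
    "G y \<bullet> ?d - G x \<bullet> ?d = H (x + s *\<^sub>R ?d) ?d \<bullet> ?d"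
    by auto
  also have "0 \<le> \<dots>"
    using H_psd[of ?d] by (simp only: inner_commute)
  finally show ?thesis
    by (simp only: inner_diff_left)
qed

text \<open>If the residual vanished, monotonicity would give \<open>x \<bullet> (x - z) \<le> 0\<close>: \<open>x\<close> lies in the ball that has
the segment from \<open>0\<close> to \<open>z\<close> as a diameter. A residual of relative size \<open>c\<close> enlarges the radius of that
ball by at most \<open>c\<close>, as completing the square around its center \<open>z/2\<close> shows.\<close>

lemma norm_le_of_regularized_residual:
  assumes zero: "G z = 0" and \<mu>: "0 < \<mu>" and res: "norm (G x + \<mu> *\<^sub>R x) \<le> c * \<mu>"
  shows "norm x \<le> norm z + c"
proof -
  define p where "p = (1 / \<mu>) *\<^sub>R (G x + \<mu> *\<^sub>R x)"
  have "norm p = norm (G x + \<mu> *\<^sub>R x) / \<mu>"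
    unfolding p_def using \<mu> by (simp del: scaleR_add_right)
  then have p: "norm p \<le> c"
    using res \<mu> by (simp add: pos_divide_le_eq)
  have G: "G x = \<mu> *\<^sub>R (p - x)"
    using \<mu> by (simp add: p_def scaleR_diff_right)
  have "0 \<le> \<mu> * ((p - x) \<bullet> (x - z))"
    using monotone_field[of x z] zero by (simp add: G)
  then have "x \<bullet> (x - z) \<le> p \<bullet> (x - z)"
    using \<mu> by (simp add: zero_le_mult_iff inner_diff_left)
  also have "\<dots> \<le> norm p * norm (x - z)"
    by (rule norm_cauchy_schwarz)
  also have "\<dots> \<le> c * norm (x - z)"
    using p by (simp add: mult_right_mono)
  finally have main: "x \<bullet> (x - z) \<le> c * norm (x - z)" .
  let ?m = "x - (1/2) *\<^sub>R z"
  let ?h = "norm z / 2"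
  have half_norm: "norm ((1/2) *\<^sub>R z) = ?h" by simp
  have c: "0 \<le> c" using p norm_ge_zero order_trans by blast
  have "norm (x - z) \<le> norm ?m + ?h"
  proof -
    have "(1/2) *\<^sub>R z + (1/2) *\<^sub>R z = z" by (simp flip: scaleR_left_distrib)
    then have "x - z = ?m - (1/2) *\<^sub>R z" by (metis diff_diff_add)
    moreover have "norm (?m - (1/2) *\<^sub>R z) \<le> norm ?m + norm ((1/2) *\<^sub>R z)"
      by (rule norm_triangle_ineq4)
    ultimately show ?thesis by (metis half_norm)
  qed
  moreover have "(norm ?m - ?h) * (norm ?m + ?h) = x \<bullet> (x - z)"
  proof -
    have "(norm ?m)\<^sup>2 - ?h\<^sup>2 = ?m \<bullet> ?m - (z \<bullet> z) / 4"
      by (simp add: power2_norm_eq_inner power_divide)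
    also have "\<dots> = x \<bullet> (x - z)"
      by (simp add: inner_diff_left inner_diff_right inner_commute[of z x] field_simps)
    finally show ?thesis
      by (simp add: power2_eq_square algebra_simps)
  qed
  ultimately have "(norm ?m - ?h) * (norm ?m + ?h) \<le> c * (norm ?m + ?h)"
    using main c mult_left_mono order_trans by metis
  then have "norm ?m - ?h \<le> c \<or> norm ?m + ?h = 0"
    by (metis add_nonneg_nonneg divide_nonneg_nonneg linorder_not_less mult_le_cancel_right
        norm_ge_zero order_le_less zero_le_numeral)
  then have "norm ?m \<le> ?h + c"
    using c norm_ge_zero[of ?m] norm_ge_zero[of z] by linarith
  moreover have "norm x \<le> norm ?m + ?h"
    using norm_triangle_ineq[of ?m "(1/2) *\<^sub>R z"] by simp
  ultimately show ?thesis by linarith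
qed

text \<open>The two equations for \<open>d\<close> hold when \<open>d = v/t\<close> comes from a solution of the homogeneous model. With
\<open>e = \<delta> - \<mu>\<close> they say that the new residual vector is \<open>r - e d\<close>, where \<open>r\<close> is the Taylor remainder, and
that \<open>d \<bullet> H x d = e - \<delta> \<parallel>d\<parallel>\<^sup>2\<close>. As \<open>e \<le> s \<mu> \<parallel>d\<parallel>\<close>, the curvature is at most \<open>\<mu> \<parallel>d\<parallel> (s - \<parallel>d\<parallel>)\<close>; this gives both
\<open>\<parallel>d\<parallel> \<le> s\<close> and, by the inequality of the means, the factor \<open>s\<^sup>2/4\<close>.\<close>

lemma homogeneous_step_contraction:
  assumes \<mu>: "0 < \<mu>" "\<mu> \<le> \<delta>"
    and step: "H x d + \<delta> *\<^sub>R d = - (G x + \<mu> *\<^sub>R x)"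
    and multiplier: "(G x + \<mu> *\<^sub>R x) \<bullet> d = \<mu> - \<delta>"
    and res: "norm (G x + \<mu> *\<^sub>R x) \<le> s * \<mu>"
    and s: "2 * \<beta> * s \<le> 4 / 3"
  shows "norm (G (x + d) + \<mu> *\<^sub>R (x + d)) \<le> s\<^sup>2 * (s + \<beta> / 2) * \<mu>"
proof -
  define p where "p = G x + \<mu> *\<^sub>R x"
  define e where "e = \<delta> - \<mu>"
  let ?D = "norm d"
  have e0: "0 \<le> e" using \<mu> by (simp add: e_def)
  have "e = - (p \<bullet> d)"
    using multiplier by (simp add: e_def p_def)
  also have "\<dots> \<le> norm p * ?D"
    using Cauchy_Schwarz_ineq2[of p d] by linarith
  also have "\<dots> \<le> s * \<mu> * ?D"
    using res by (simp add: p_def mult_right_mono)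
  finally have e_le: "e \<le> s * \<mu> * ?D" .
  have Hd: "H x d = - p - \<delta> *\<^sub>R d"
    using step by (simp add: p_def algebra_simps)
  have curv: "d \<bullet> H x d = e - \<delta> * ?D\<^sup>2"
    using multiplier
    by (simp add: Hd p_def[symmetric] e_def inner_diff_right inner_commute power2_norm_eq_inner)
  have \<delta>D: "\<mu> * ?D\<^sup>2 \<le> \<delta> * ?D\<^sup>2"
    using \<mu> by (intro mult_right_mono) auto
  have "\<mu> * ?D\<^sup>2 \<le> s * \<mu> * ?D"
    using \<delta>D H_psd[of d x] e_le curv by linarith
  then have "?D * ?D \<le> s * ?D"
    using \<mu> by (simp add: power2_eq_square mult_ac)
  moreover have "0 \<le> s"
    using res \<mu> by (meson norm_ge_zero order_trans zero_le_mult_iff not_le)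
  ultimately have D: "?D \<le> s"
    by (metis mult_right_le_imp_le norm_ge_zero order_le_less)
  define r where "r = G (x + d) - G x - H x d"
  have "2 * \<beta> * ?D \<le> 4 / 3"
    using D s beta_pos mult_left_mono[OF D, of "2 * \<beta>"] by linarith
  then have "norm r \<le> 2 * \<beta> * (e - \<delta> * ?D\<^sup>2)"
    unfolding r_def curv[symmetric] by (rule concordance_long_step)
  also have "\<dots> \<le> 2 * \<beta> * (s * \<mu> * ?D - \<mu> * ?D\<^sup>2)"
    using beta_pos e_le \<delta>D by (intro mult_left_mono) auto
  also have "\<dots> = 2 * \<beta> * \<mu> * (?D * (s - ?D))"
    by (simp add: power2_eq_square algebra_simps)
  also have "\<dots> \<le> 2 * \<beta> * \<mu> * (s\<^sup>2 / 4)"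
  proof (rule mult_left_mono)
    have "0 \<le> (s / 2 - ?D)\<^sup>2" by simp
    then show "?D * (s - ?D) \<le> s\<^sup>2 / 4"
      by (simp add: power2_eq_square algebra_simps)
  qed (use beta_pos \<mu> in simp)
  finally have r: "norm r \<le> s\<^sup>2 * (\<beta> / 2) * \<mu>"
    by (simp add: mult_ac)
  have "e * ?D \<le> s * \<mu> * ?D * ?D"
    using e_le by (intro mult_right_mono) auto
  also have "\<dots> = s * \<mu> * (?D * ?D)"
    by simp
  also have "\<dots> \<le> s * \<mu> * (s * s)"
    using D \<open>0 \<le> s\<close> \<mu> by (intro mult_left_mono mult_mono) auto
  finally have ed: "norm (e *\<^sub>R d) \<le> s\<^sup>2 * s * \<mu>"
    using e0 by (simp add: power2_eq_square mult_ac)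
  have "G (x + d) + \<mu> *\<^sub>R (x + d) = r - e *\<^sub>R d"
    by (simp add: r_def Hd p_def e_def algebra_simps)
  then show ?thesis
    using norm_triangle_ineq4[of r "e *\<^sub>R d"] r ed by (simp add: distrib_left distrib_right)
qed

end

section \<open>Solutions of the homogeneous model\<close>

text \<open>By homogeneity, and because the minimum \<open>m\<close> is negative, \<open>z\<close> lies on the unit sphere and
\<open>w \<bullet> A w - m (w \<bullet> w)\<close> is a nonnegative quadratic form that vanishes at \<open>z\<close>. Hence its derivative at
\<open>z\<close> vanishes in the direction \<open>y = A z - m z\<close>, which says \<open>y \<bullet> y = 0\<close>.\<close>

lemma quadratic_form_minimizer_is_eigenvector:
  fixes A :: "'a::real_inner \<Rightarrow> 'a"
  assumes lin: "linear A"
    and sym: "\<And>u v. A u \<bullet> v = A v \<bullet> u"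
    and min: "is_arg_min (\<lambda>w. w \<bullet> A w) (\<lambda>w. norm w \<le> 1) z"
    and neg: "z \<bullet> A z < 0"
  shows "A z = (z \<bullet> A z) *\<^sub>R z"
proof -
  define m where "m = z \<bullet> A z"
  have le: "m * (w \<bullet> w) \<le> w \<bullet> A w" for w
  proof (cases "w = 0")
    case False
    then have "m \<le> (w /\<^sub>R norm w) \<bullet> A (w /\<^sub>R norm w)"
      using min unfolding is_arg_min_linorder m_def by (auto simp del: inner_scaleR_left)
    then have "m * (norm w * norm w) \<le> w \<bullet> A w"
      using False by (simp add: linear_cmul[OF lin] field_simps)
    then show ?thesis
      by (simp add: norm_eq_sqrt_inner)
  qed (simp add: linear_0[OF lin])
  have "z \<bullet> z \<le> 1"
    using min by (simp add: is_arg_min_linorder norm_eq_sqrt_inner)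
  with neg have "m \<le> m * (z \<bullet> z)"
    by (simp add: m_def)
  then have zz: "m * (z \<bullet> z) = m"
    using le[of z] by (simp add: m_def)
  define y where "y = A z - m *\<^sub>R z"
  define q where "q = y \<bullet> A y - m * (y \<bullet> y)"
  have q: "0 \<le> q" using le[of y] by (simp add: q_def)
  have "0 \<le> 2 * c * (y \<bullet> y) + c\<^sup>2 * q" for c
  proof -
    have "(z + c *\<^sub>R y) \<bullet> A (z + c *\<^sub>R y) - m * ((z + c *\<^sub>R y) \<bullet> (z + c *\<^sub>R y))
        = (z \<bullet> A z - m * (z \<bullet> z)) + 2 * c * (y \<bullet> (A z - m *\<^sub>R z)) + c\<^sup>2 * q"
      using sym[of z y] unfolding q_def
      by (simp add: linear_add[OF lin] linear_cmul[OF lin] inner_add_left inner_add_right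
          inner_diff_right inner_commute power2_eq_square algebra_simps)
    also have "\<dots> = 2 * c * (y \<bullet> y) + c\<^sup>2 * q"
      using zz by (simp add: m_def y_def)
    finally show ?thesis
      using le[of "z + c *\<^sub>R y"] by linarith
  qed
  \<comment> \<open>Take \<open>c = - (y \<bullet> y) / (q + 1)\<close>; the summand \<open>1\<close> keeps the denominator positive when \<open>q = 0\<close>.\<close>
  then have "0 \<le> (q + 1)\<^sup>2 * (2 * (- (y \<bullet> y) / (q + 1)) * (y \<bullet> y) + (- (y \<bullet> y) / (q + 1))\<^sup>2 * q)"
    by (rule mult_nonneg_nonneg[OF zero_le_power2])
  also have "\<dots> = - ((y \<bullet> y)\<^sup>2 * (q + 2))"
  proof -
    have "k\<^sup>2 * (2 * (- Y / k) * Y + (- Y / k)\<^sup>2 * q) = Y\<^sup>2 * (q - 2 * k)" if "0 < k" for k Y :: real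
      using that by (simp add: power2_eq_square field_simps)
    from this[of "q + 1"] q show ?thesis
      by (simp add: algebra_simps)
  qed
  finally have "(y \<bullet> y)\<^sup>2 * (q + 2) \<le> 0"
    by simp
  then have "y \<bullet> y = 0"
    using q by (simp add: mult_le_0_iff)
  then show ?thesis
    by (simp add: y_def m_def)
qed

text \<open>Comparison with \<open>[0; 1]\<close> shows that the least eigenvalue \<open>-\<delta>\<close> is at most \<open>-\<mu>\<close>. If \<open>t\<close> were \<open>0\<close>, then
\<open>v\<close> would be an eigenvector of the positive semidefinite \<open>H\<close> for the negative eigenvalue \<open>-\<delta>\<close>. The two
equations are the block rows of the eigenvalue equation divided by \<open>t\<close>.\<close>

lemma ghm_solution_step:
  fixes H :: "real^'n^'n"
  assumes sym: "\<And>u v. (H *v u) \<bullet> v = (H *v v) \<bullet> u"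
    and psd: "\<And>u. 0 \<le> u \<bullet> (H *v u)"
    and \<mu>: "0 < \<mu>"
    and sol: "ghm_solution H p \<mu> (v, t)"
  obtains \<delta> where "\<mu> \<le> \<delta>" "t \<noteq> 0"
    "H *v (v /\<^sub>R t) + \<delta> *\<^sub>R (v /\<^sub>R t) = - p" "p \<bullet> (v /\<^sub>R t) = \<mu> - \<delta>"
proof -
  let ?A = "ghm_op H p \<mu>"
  define \<delta> where "\<delta> = - ((v, t) \<bullet> ?A (v, t))"
  have min: "is_arg_min (\<lambda>z. z \<bullet> ?A z) (\<lambda>z. norm z \<le> 1) (v, t)"
    using sol by (simp add: ghm_solution_def)
  have "(v, t) \<bullet> ?A (v, t) \<le> (0, 1) \<bullet> ?A (0, 1)"
    using min unfolding is_arg_min_linorder by (auto simp: norm_Pair)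
  then have \<delta>: "\<mu> \<le> \<delta>"
    by (simp add: \<delta>_def ghm_op_def)
  have lin: "linear ?A"
    by (rule linearI)
      (auto simp: ghm_op_def matrix_vector_right_distrib matrix_vector_mult_scaleR
        algebra_simps split: prod.splits)
  have A_sym: "?A y \<bullet> z = ?A z \<bullet> y" for y z
    using sym[of "fst y" "fst z"]
    by (cases y; cases z) (simp add: ghm_op_def inner_add_left inner_commute algebra_simps)
  have "?A (v, t) = ((v, t) \<bullet> ?A (v, t)) *\<^sub>R (v, t)"
    using \<delta> \<mu> by (intro quadratic_form_minimizer_is_eigenvector lin A_sym min) (simp add: \<delta>_def)
  then have ev: "?A (v, t) = - \<delta> *\<^sub>R (v, t)"
    by (simp add: \<delta>_def)
  have ev1: "H *v v + t *\<^sub>R p = - \<delta> *\<^sub>R v" and ev2: "p \<bullet> v - \<mu> * t = - \<delta> * t"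
    using ev by (auto simp: ghm_op_def)
  have t: "t \<noteq> 0"
  proof
    assume t0: "t = 0"
    then have "v \<bullet> (H *v v) = - \<delta> * (v \<bullet> v)"
      using ev1 by simp
    then have "0 \<le> - \<delta> * (v \<bullet> v)"
      using psd[of v] by simp
    then have "v \<bullet> v \<le> 0"
      using \<delta> \<mu> by (simp add: mult_le_0_iff)
    then have "v = 0" by (metis inner_eq_zero_iff inner_ge_zero order_antisym)
    with t0 \<delta> \<mu> show False by (simp add: \<delta>_def ghm_op_def)
  qed
  show thesis
  proof (rule that[OF \<delta> t])
    have "inverse t *\<^sub>R (H *v v + t *\<^sub>R p) = inverse t *\<^sub>R (- \<delta> *\<^sub>R v)"
      by (simp only: ev1)
    then show "H *v (v /\<^sub>R t) + \<delta> *\<^sub>R (v /\<^sub>R t) = - p"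
      using t by (simp add: matrix_vector_mult_scaleR scaleR_add_right eq_neg_iff_add_eq_0 add_ac mult_ac)
    show "p \<bullet> (v /\<^sub>R t) = \<mu> - \<delta>"
      using ev2 t by (simp add: field_simps)
  qed
qed

section \<open>The residual across one outer iteration\<close>

text \<open>The residual relative to \<open>\<mu>\<close> with which every outer iteration starts is at most this number: the
first term is the residual at return, the second pays for the decrease of \<open>\<mu>\<close>.\<close>

definition restart_residual :: "real \<Rightarrow> real" where
  "restart_residual \<beta> = 1 / (1 + 3 * (\<beta> + 1)) + 1 / (3 * (\<beta> + 1))"

text \<open>These inequalities let the contraction estimate apply with \<open>s = restart_residual \<beta>\<close> and make
one step restore approximate centering. In terms of \<open>a = 3(\<beta> + 1)\<close> the second one is a polynomial
inequality for \<open>a \<ge> 3\<close>, and all coefficients are positive after expansion around \<open>a = 3\<close>.\<close>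

lemma restart_residual_bounds:
  assumes "0 < \<beta>"
  shows "2 * \<beta> * restart_residual \<beta> \<le> 4 / 3"
    and "(restart_residual \<beta>)\<^sup>2 * (restart_residual \<beta> + \<beta> / 2) \<le> 1 / (1 + 3 * (\<beta> + 1))"
proof -
  define a where "a = 3 * (\<beta> + 1)"
  have a: "3 < a" and \<beta>: "\<beta> = (a - 3) / 3"
    using assms by (auto simp: a_def)
  have R: "restart_residual \<beta> = (2 * a + 1) / (a * (1 + a))"
    unfolding restart_residual_def a_def[symmetric] using a by (simp add: field_simps)
  have pos: "0 < a * (1 + a)" using a by simp
  show "2 * \<beta> * restart_residual \<beta> \<le> 4 / 3"
  proof -
    have "2 * (a - 3) * (2 * a + 1) \<le> 4 * (a * (1 + a))"
      using a by (simp add: algebra_simps)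
    then show ?thesis
      unfolding R unfolding \<beta> using pos by (simp add: field_simps)
  qed
  have "(2 * a + 1)\<^sup>2 * (6 * (2 * a + 1) + (a - 3) * (a * (1 + a))) \<le> 6 * a ^ 3 * (1 + a)\<^sup>2"
  proof -
    define b where "b = a - 3"
    have b: "0 \<le> b" and ab: "a = b + 3" using a by (auto simp: b_def)
    have "6 * a ^ 3 * (1 + a)\<^sup>2 - (2 * a + 1)\<^sup>2 * (6 * (2 * a + 1) + (a - 3) * (a * (1 + a))) =
        2 * b ^ 5 + 46 * b ^ 4 + 349 * b ^ 3 + 1139 * b\<^sup>2 + 1536 * b + 534"
      unfolding ab by (simp add: power2_eq_square power3_eq_cube power_numeral_reduce algebra_simps)
    also have "0 \<le> \<dots>" using b by simp
    finally show ?thesis by (simp only: diff_ge_0_iff_ge)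
  qed
  then have "(2 * a + 1)\<^sup>2 * (6 * (2 * a + 1) + (a - 3) * (a * (1 + a))) / (6 * (a * (1 + a)) ^ 3)
      \<le> 6 * a ^ 3 * (1 + a)\<^sup>2 / (6 * (a * (1 + a)) ^ 3)"
    using pos by (intro divide_right_mono) auto
  also have "\<dots> = 1 / (1 + a)"
    using a by (simp add: power_mult_distrib power2_eq_square power3_eq_cube)
  also have "(2 * a + 1)\<^sup>2 * (6 * (2 * a + 1) + (a - 3) * (a * (1 + a))) / (6 * (a * (1 + a)) ^ 3)
      = (restart_residual \<beta>)\<^sup>2 * (restart_residual \<beta> + \<beta> / 2)"
  proof -
    have "N\<^sup>2 * (6 * N + (a - 3) * c) / (6 * c ^ 3) = (N / c)\<^sup>2 * (N / c + (a - 3) / 3 / 2)"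
      if "0 < c" for N c :: real
      using that by (simp add: power2_eq_square power3_eq_cube field_simps)
    from this[OF pos] show ?thesis
      unfolding R unfolding \<beta> .
  qed
  finally show "(restart_residual \<beta>)\<^sup>2 * (restart_residual \<beta> + \<beta> / 2) \<le> 1 / (1 + 3 * (\<beta> + 1))"
    by (simp add: a_def)
qed

lemma shrink_factor_pos:
  assumes "0 < \<beta>"
  shows "0 < shrink_factor \<beta> x"
proof -
  have "0 < 3 * (\<beta> + 1) * (1 + norm x)"
    using assms norm_ge_zero[of x] by (intro mult_pos_pos) linarith+
  then show ?thesis
    unfolding shrink_factor_def by simp
qed

lemma shrink_factor_mono:
  assumes "0 < \<beta>" "norm x \<le> R"
  shows "shrink_factor \<beta> x \<le> 3 * (\<beta> + 1) * (1 + R) / (1 + 3 * (\<beta> + 1) * (1 + R))"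
proof -
  have mono: "u / (1 + u) \<le> w / (1 + w)" if "0 \<le> u" "u \<le> w" for u w :: real
    using that by (simp add: field_simps)
  show ?thesis
    unfolding shrink_factor_def using assms by (intro mono mult_left_mono) auto
qed

text \<open>Replacing \<open>\<mu>\<close> by \<open>\<rho> \<mu>\<close> changes the residual vector by \<open>(1 - \<rho>) \<mu> x\<close>. The shrink factor is chosen so
that \<open>(1 - \<rho>) / \<rho> = 1 / (a (1 + \<parallel>x\<parallel>))\<close> with \<open>a = 3(\<beta> + 1)\<close>; relative to
the new \<open>\<mu>\<close>, this change and the growth of the old residual by \<open>1/\<rho>\<close> then cost at most \<open>1/a\<close> together,
whatever the norm of \<open>x\<close> is.\<close>

lemma restart_residual_after_shrink:
  fixes g x :: "real^'n"
  assumes \<beta>: "0 < \<beta>" and \<mu>: "0 < \<mu>"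
    and centered: "norm (g + \<mu> *\<^sub>R x) \<le> \<mu> / (1 + 3 * (\<beta> + 1))"
  shows "norm (g + (shrink_factor \<beta> x * \<mu>) *\<^sub>R x)
    \<le> restart_residual \<beta> * (shrink_factor \<beta> x * \<mu>)"
proof -
  define a where "a = 3 * (\<beta> + 1)"
  define Y where "Y = 1 + norm x"
  define \<rho> where "\<rho> = shrink_factor \<beta> x"
  have a: "0 < a" and Y: "1 \<le> Y" using \<beta> by (auto simp: a_def Y_def)
  then have aY: "0 < a * Y" by simp
  have \<rho>: "\<rho> = a * Y / (1 + a * Y)"
    by (simp add: \<rho>_def shrink_factor_def a_def Y_def)
  have one_minus: "1 - \<rho> = 1 / (1 + a * Y)"
    using aY unfolding \<rho> by (simp add: field_simps)
  have "g + (\<rho> * \<mu>) *\<^sub>R x = (g + \<mu> *\<^sub>R x) - ((1 - \<rho>) * \<mu>) *\<^sub>R x"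
    by (simp add: algebra_simps)
  then have "norm (g + (\<rho> * \<mu>) *\<^sub>R x) \<le> norm (g + \<mu> *\<^sub>R x) + norm (((1 - \<rho>) * \<mu>) *\<^sub>R x)"
    using norm_triangle_ineq4 by metis
  also have "norm (((1 - \<rho>) * \<mu>) *\<^sub>R x) = (Y - 1) / (1 + a * Y) * \<mu>"
    using \<mu> aY by (simp add: one_minus Y_def abs_mult)
  also have "norm (g + \<mu> *\<^sub>R x) + (Y - 1) / (1 + a * Y) * \<mu> 
      \<le> (1 / (1 + a) + (Y - 1) / (1 + a * Y)) * \<mu>"
    using centered by (simp add: a_def algebra_simps)
  also have "\<dots> \<le> (1 / (1 + a) + 1 / a) * \<rho> * \<mu>"
  proof (rule mult_right_mono)
    have "1 / a * \<rho> = Y * (1 / (1 + a * Y))"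
      using a by (simp add: \<rho>)
    moreover have "\<rho> = 1 - 1 / (1 + a * Y)"
      using one_minus by simp
    ultimately have "(1 / (1 + a) + 1 / a) * \<rho> - (1 / (1 + a) + (Y - 1) * (1 / (1 + a * Y)))
        = 1 / (1 + a) * (1 - 1 / (1 + a * Y)) + Y * (1 / (1 + a * Y))
          - (1 / (1 + a) + (Y - 1) * (1 / (1 + a * Y)))"
      by (simp only: distrib_right)
    also have "\<dots> = (1 - 1 / (1 + a)) * (1 / (1 + a * Y))"
      by (simp only: algebra_simps)
    also have "0 \<le> \<dots>"
      using a aY by simp
    finally show "1 / (1 + a) + (Y - 1) / (1 + a * Y) \<le> (1 / (1 + a) + 1 / a) * \<rho>"
      by simp
  qed (use \<mu> in simp)
  finally show ?thesis
    by (simp add: \<rho>_def restart_residual_def a_def mult.assoc)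
qed

section \<open>Gradients and minimizers\<close>

lemma GDERIV_gradient:
  fixes f :: "real^'n \<Rightarrow> real"
  assumes "f differentiable at x"
  shows "GDERIV f x :> gradient f x"
proof -
  obtain f' where f': "(f has_derivative f') (at x)"
    using assms by (auto simp: differentiable_def)
  define g where "g = adjoint f' 1"
  have g: "f' = (\<lambda>h. h \<bullet> g)"
    using adjoint_works[OF has_derivative_linear[OF f'], of _ 1] by (simp add: g_def fun_eq_iff)
  have "GDERIV f x :> g"
    using f' by (simp add: g gderiv_def)
  moreover have "g' = g" if "GDERIV f x :> g'" for g'
  proof -
    have "(\<lambda>h. h \<bullet> g') = (\<lambda>h. h \<bullet> g)"
      using has_derivative_unique[of f "\<lambda>h. h \<bullet> g'" x f'] that f' by (simp only: gderiv_def g)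
    then show ?thesis
      by (simp only: fun_eq_iff vector_eq_ldot)
  qed
  ultimately show ?thesis
    unfolding gradient_def by (rule theI)
qed

lemma gradient_zero_at_minimizer:
  fixes f :: "real^'n \<Rightarrow> real"
  assumes "f differentiable at x" and "is_arg_min f (\<lambda>_. True) x"
  shows "gradient f x = 0"
proof -
  have "(f has_derivative (\<lambda>h. h \<bullet> gradient f x)) (at x)"
    using GDERIV_gradient[OF assms(1)] by (simp add: gderiv_def)
  moreover have "\<forall>y\<in>UNIV. f x \<le> f y"
    using assms(2) by (simp add: is_arg_min_linorder)
  ultimately have "(\<lambda>h. h \<bullet> gradient f x) = (\<lambda>h. 0)"
    by (intro differential_zero_maxmin[of x UNIV f]) auto
  then have "gradient f x \<bullet> gradient f x = 0"
    by (rule fun_cong)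
  then show ?thesis
    by simp
qed

text \<open>The minimizers form a nonempty closed set, so one of least norm exists and \<open>ARG_MIN\<close> returns a
minimizer.\<close>

lemma min_norm_minimizer_is_minimizer:
  fixes f :: "real^'n \<Rightarrow> real"
  assumes cont: "continuous_on UNIV f" and ex: "\<exists>x. is_arg_min f (\<lambda>_. True) x"
  shows "is_arg_min f (\<lambda>_. True) (min_norm_minimizer f)"
proof -
  let ?M = "{x. is_arg_min f (\<lambda>_. True) x}"
  obtain m where m: "is_arg_min f (\<lambda>_. True) m"
    using ex by blast
  then have "?M = {x. f x = f m}"
    by (auto simp: is_arg_min_linorder order_antisym)
  then have "closed ?M"
    using closed_Collect_eq[OF cont continuous_on_const] by simp
  then obtain x where "x \<in> ?M" "\<And>y. y \<in> ?M \<Longrightarrow> dist 0 x \<le> dist 0 y"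
    using distance_attains_inf[of ?M 0] m by blast
  then have "is_arg_min norm (is_arg_min f (\<lambda>_. True)) x"
    by (auto simp: is_arg_min_linorder)
  then have "is_arg_min norm (is_arg_min f (\<lambda>_. True)) (min_norm_minimizer f)"
    unfolding min_norm_minimizer_def arg_min_def by (rule someI)
  then show ?thesis
    by (simp add: is_arg_min_def)
qed

section \<open>The homotopy method\<close>

locale homotopy_hsodm =
  fixes f :: "real^'n \<Rightarrow> real" and \<beta> :: real and S :: "nat \<Rightarrow> nat \<Rightarrow> 'n solver"
  assumes smooth: "twice_continuously_differentiable f"
    and concordant: "concordant_lipschitz f \<beta>"
    and solver: "ghm_solution H p \<mu> (S k j H p \<mu>)"
begin

lemma differentiable: "f differentiable at x"
  using smooth by (simp add: twice_continuously_differentiable_def)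

lemma beta_pos: "0 < \<beta>"
  using concordant by (simp add: concordant_lipschitz_def)

lemma gradient_has_derivative: "(gradient f has_derivative (\<lambda>h. hessian f x *v h)) (at x)"
  using smooth by (simp add: twice_continuously_differentiable_def hessian_def flip: jacobian_works)

lemma concordant_gradient: "\<exists>C. concordant_field (gradient f) (\<lambda>x d. hessian f x *v d) \<beta> C"
  using concordant gradient_has_derivative
  unfolding concordant_lipschitz_def concordant_field_def by blast

lemma hessian_symmetric: "(hessian f x *v u) \<bullet> v = (hessian f x *v v) \<bullet> u"
  by (rule second_derivative_symmetric[OF GDERIV_gradient[OF differentiable] gradient_has_derivative])

text \<open>Every model posed at \<open>x\<close> has a usable solution, and the step taken from \<open>x\<close> ends in an
approximately centered point. The iterate after one step uses the solver with inner index \<open>0\<close>;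
the first claim is needed for every \<open>j\<close>.\<close>

lemma one_model_suffices:
  assumes \<mu>: "0 < \<mu>"
    and res: "norm (gradient f x + \<mu> *\<^sub>R x) \<le> restart_residual \<beta> * \<mu>"
  shows "snd (model_solution (S k j) f \<mu> x) \<noteq> 0"
    and "approx_centered f \<beta> \<mu> (inner_iterate (S k) f \<mu> x 1)"
proof -
  obtain C where "concordant_field (gradient f) (\<lambda>x d. hessian f x *v d) \<beta> C"
    using concordant_gradient by blast
  then interpret concordant_field "gradient f" "\<lambda>x d. hessian f x *v d" \<beta> C .
  have step: "\<exists>v t. model_solution (S k j) f \<mu> x = (v, t) \<and> t \<noteq> 0 \<and>
      norm (gradient f (x + v /\<^sub>R t) + \<mu> *\<^sub>R (x + v /\<^sub>R t)) \<le> \<mu> / (1 + 3 * (\<beta> + 1))" for j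
  proof -
    obtain v t where vt: "model_solution (S k j) f \<mu> x = (v, t)"
      by fastforce
    then have "ghm_solution (hessian f x) (gradient f x + \<mu> *\<^sub>R x) \<mu> (v, t)"
      using solver[of "hessian f x" "gradient f x + \<mu> *\<^sub>R x" \<mu> k j] by (simp add: model_solution_def)
    from ghm_solution_step[OF hessian_symmetric H_psd \<mu> this] obtain \<delta> where \<delta>: "\<mu> \<le> \<delta>"
      and t: "t \<noteq> 0"
      and eqs: "hessian f x *v (v /\<^sub>R t) + \<delta> *\<^sub>R (v /\<^sub>R t) = - (gradient f x + \<mu> *\<^sub>R x)"
        "(gradient f x + \<mu> *\<^sub>R x) \<bullet> (v /\<^sub>R t) = \<mu> - \<delta>" .
    have "norm (gradient f (x + v /\<^sub>R t) + \<mu> *\<^sub>R (x + v /\<^sub>R t))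
        \<le> (restart_residual \<beta>)\<^sup>2 * (restart_residual \<beta> + \<beta> / 2) * \<mu>"
      by (rule homogeneous_step_contraction[OF \<mu> \<delta> eqs res restart_residual_bounds(1)[OF beta_pos]])
    also have "\<dots> \<le> 1 / (1 + 3 * (\<beta> + 1)) * \<mu>"
      using \<mu> by (intro mult_right_mono restart_residual_bounds(2) beta_pos) auto
    finally show ?thesis
      using vt t by simp
  qed
  show "snd (model_solution (S k j) f \<mu> x) \<noteq> 0"
    using step[of j] by auto
  show "approx_centered f \<beta> \<mu> (inner_iterate (S k) f \<mu> x 1)"
    using step[of 0] by (auto simp: approx_centered_def)
qed

text \<open>The point \<open>x\<^bsub>k,0\<^esub>\<close>. For \<open>k > 0\<close> it is also the point returned by outer iteration \<open>k - 1\<close>.\<close>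

abbreviation outer_start :: "nat \<Rightarrow> real^'n" where
  "outer_start k \<equiv> fst (hsodm_state S f \<beta> k)"

abbreviation mu :: "nat \<Rightarrow> real" where
  "mu k \<equiv> hsodm_mu S f \<beta> k"

lemma outer_start_Suc:
  "outer_start (Suc k) = hsodm_iterate S f \<beta> k (hsodm_inner_count S f \<beta> k)"
  by (simp add: hsodm_iterate_def hsodm_inner_count_def hsodm_mu_def Let_def split: prod.splits)

lemma mu_Suc: "mu (Suc k) = shrink_factor \<beta> (outer_start (Suc k)) * mu k"
  by (simp add: hsodm_mu_def Let_def split: prod.splits)

lemma mu_0: "mu 0 = 2 * (\<beta> + 1) * (1 + (norm (gradient f 0))\<^sup>2)"
  by (simp add: hsodm_mu_def)

lemma mu_pos: "0 < mu k"
proof (induction k)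
  case 0
  have "0 < 1 + (norm (gradient f 0))\<^sup>2"
    by (simp add: add_pos_nonneg)
  then show ?case using beta_pos by (simp add: mu_0)
next
  case (Suc k)
  then show ?case
    unfolding mu_Suc by (intro mult_pos_pos shrink_factor_pos beta_pos)
qed

lemma inner_count_le_one_if_residual:
  assumes "norm (gradient f (outer_start k) + mu k *\<^sub>R outer_start k) \<le> restart_residual \<beta> * mu k"
  shows "hsodm_inner_count S f \<beta> k \<le> 1" "approx_centered f \<beta> (mu k) (outer_start (Suc k))"
proof -
  have "approx_centered f \<beta> (mu k) (inner_iterate (S k) f (mu k) (outer_start k) 1)"
    by (rule one_model_suffices(2)[OF mu_pos assms])
  then show "hsodm_inner_count S f \<beta> k \<le> 1" "approx_centered f \<beta> (mu k) (outer_start (Suc k))"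
    unfolding outer_start_Suc hsodm_inner_count_def hsodm_iterate_def inner_count_def
    by (rule Least_le, rule LeastI)
qed

text \<open>This is what the choice of \<open>\<mu>\<^sub>0\<close> is for: \<open>1 + n\<^sup>2 \<ge> 2n\<close> for \<open>n = \<parallel>\<nabla>f(0)\<parallel>\<close>, hence \<open>\<mu>\<^sub>0 \<ge> 4(\<beta>+1)n\<close>, and
\<open>4(\<beta>+1) \<ge> 1 + 3(\<beta>+1)\<close>.\<close>

lemma start_centered: "approx_centered f \<beta> (mu 0) 0"
proof -
  let ?n = "norm (gradient f 0)"
  have "0 \<le> (?n - 1)\<^sup>2" by simp
  then have "2 * ?n \<le> 1 + ?n\<^sup>2"
    by (simp add: power2_eq_square algebra_simps)
  then have "2 * (\<beta> + 1) * (2 * ?n) \<le> mu 0"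
    unfolding mu_0 using beta_pos by (intro mult_left_mono) auto
  moreover have "0 \<le> \<beta> * ?n" using beta_pos by simp
  ultimately have "?n * (1 + 3 * (\<beta> + 1)) \<le> mu 0"
    by (simp add: algebra_simps)
  then show ?thesis
    using beta_pos by (simp add: approx_centered_def pos_le_divide_eq)
qed

lemma restart_residual_le:
  "norm (gradient f (outer_start k) + mu k *\<^sub>R outer_start k) \<le> restart_residual \<beta> * mu k"
proof (induction k)
  case 0
  have "1 / (1 + 3 * (\<beta> + 1)) * mu 0 \<le> restart_residual \<beta> * mu 0"
    using beta_pos mu_pos[of 0] by (intro mult_right_mono) (auto simp: restart_residual_def)
  then show ?case
    using start_centered by (simp add: approx_centered_def)
next
  case (Suc k)
  have "norm (gradient f (outer_start (Suc k)) + mu k *\<^sub>R outer_start (Suc k)) \<le> mu k / (1 + 3 * (\<beta> + 1))"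
    using inner_count_le_one_if_residual(2)[OF Suc] unfolding approx_centered_def .
  then show ?case
    unfolding mu_Suc by (rule restart_residual_after_shrink[OF beta_pos mu_pos])
qed

lemmas inner_count_le_one = inner_count_le_one_if_residual(1)[OF restart_residual_le]
lemmas outer_start_Suc_centered = inner_count_le_one_if_residual(2)[OF restart_residual_le]

lemma inner_count_0: "hsodm_inner_count S f \<beta> 0 = 0"
proof -
  have "approx_centered f \<beta> (mu 0) (inner_iterate (S 0) f (mu 0) (outer_start 0) 0)"
    using start_centered by simp
  then show ?thesis
    unfolding hsodm_inner_count_def inner_count_def by (metis Least_le le_zero_eq)
qed

lemma well_defined: "hsodm_well_defined S f \<beta>"
  unfolding hsodm_well_defined_def
proof (intro allI conjI impI)
  fix k
  show "\<exists>j. approx_centered f \<beta> (mu k) (hsodm_iterate S f \<beta> k j)"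
    using outer_start_Suc_centered[of k] unfolding outer_start_Suc by blast
  fix j
  assume "j < hsodm_inner_count S f \<beta> k"
  then have "j = 0" using inner_count_le_one[of k] by simp
  then have "hsodm_iterate S f \<beta> k j = outer_start k"
    by (simp add: hsodm_iterate_def)
  then show "snd (model_solution (S k j) f (mu k) (hsodm_iterate S f \<beta> k j)) \<noteq> 0"
    using one_model_suffices(1)[OF mu_pos restart_residual_le] by simp
qed

lemma output_eq: "hsodm_output S f \<beta> k = outer_start (Suc k)"
  by (simp add: hsodm_output_def hsodm_iterate_def)

text \<open>Of the \<open>K + 1\<close> outer iterations the first solves no model. Saving that one matters, because the
claimed bound is \<open>0\<close> when its logarithm is not positive.\<close>

lemma models_le: "(\<Sum>k\<le>K. hsodm_inner_count S f \<beta> k) \<le> K"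
proof (induction K)
  case (Suc K)
  then show ?case using inner_count_le_one[of "Suc K"] by simp
qed (simp add: inner_count_0)

lemma norm_outer_start_le:
  assumes "gradient f z = 0"
  shows "norm (outer_start (Suc k)) \<le> norm z + 1 / (1 + 3 * (\<beta> + 1))"
proof -
  obtain C where "concordant_field (gradient f) (\<lambda>x d. hessian f x *v d) \<beta> C"
    using concordant_gradient by blast
  then interpret concordant_field "gradient f" "\<lambda>x d. hessian f x *v d" \<beta> C .
  show ?thesis
    using outer_start_Suc_centered[of k]
    by (intro norm_le_of_regularized_residual[OF assms mu_pos[of k]]) (simp add: approx_centered_def)
qed

lemma gradient_output_le:
  assumes "gradient f z = 0"
  shows "norm (gradient f (hsodm_output S f \<beta> k))
    \<le> mu k * (norm z + 2 / (1 + 3 * (\<beta> + 1)))"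
proof -
  let ?x = "outer_start (Suc k)"
  have "norm (gradient f ?x) \<le> norm (gradient f ?x + mu k *\<^sub>R ?x) + norm (mu k *\<^sub>R ?x)"
    using norm_triangle_ineq4[of "gradient f ?x + mu k *\<^sub>R ?x" "mu k *\<^sub>R ?x"] by simp
  also have "norm (gradient f ?x + mu k *\<^sub>R ?x) \<le> mu k / (1 + 3 * (\<beta> + 1))"
    using outer_start_Suc_centered[of k] by (simp add: approx_centered_def)
  also have "norm (mu k *\<^sub>R ?x) \<le> mu k * (norm z + 1 / (1 + 3 * (\<beta> + 1)))"
    using mu_pos[of k] norm_outer_start_le[OF assms, of k] by simp
  finally show ?thesis
    by (simp add: output_eq algebra_simps)
qed

lemma mu_geometric:
  assumes bound: "\<And>k. shrink_factor \<beta> (outer_start (Suc k)) \<le> \<tau>"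
  shows "mu k \<le> \<tau> ^ k * mu 0"
proof (induction k)
  case (Suc k)
  have "mu (Suc k) \<le> \<tau> * mu k"
    unfolding mu_Suc using mu_pos[of k] bound by (intro mult_right_mono) auto
  also have "\<dots> \<le> \<tau> * (\<tau> ^ k * mu 0)"
    using Suc bound[of k] shrink_factor_pos[OF beta_pos, of "outer_start (Suc k)"]
    by (intro mult_left_mono) auto
  finally show ?case by simp
qed simp

end

theorem theorem4p1:
  fixes f :: "real^'n \<Rightarrow> real" and \<beta> \<epsilon> :: real and S :: "nat \<Rightarrow> nat \<Rightarrow> 'n solver"
  assumes "twice_continuously_differentiable f"
    and "concordant_lipschitz f \<beta>"
    and "\<exists>x. is_arg_min f (\<lambda>_. True) x"
    and "\<epsilon> > 0"
    and "\<And>k j H p \<mu>. ghm_solution H p \<mu> (S k j H p \<mu>)"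
  shows "let r = norm (min_norm_minimizer f);
             \<tau> = 3 * (\<beta> + 1) * (1 + 1 / (1 + 3 * (\<beta> + 1)) + r) /
                 (1 + 3 * (\<beta> + 1) * (1 + 1 / (1 + 3 * (\<beta> + 1)) + r))
         in \<tau> \<in> {0<..<1} \<and>
            hsodm_well_defined S f \<beta> \<and>
            (\<exists>K. norm (gradient f (hsodm_output S f \<beta> K)) \<le> \<epsilon>) \<and>
            hsodm_models_needed S f \<beta> \<epsilon> \<le>
              nat \<lceil>2 * log \<tau> ((1 + 3 * (\<beta> + 1)) * \<epsilon> /
                (2 * (\<beta> + 1) * (1 + (norm (gradient f 0))\<^sup>2) * ((3 * \<beta> + 4) * r + 2)))\<rceil>"
proof -
  interpret homotopy_hsodm f \<beta> S
    using assms by unfold_locales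
  define r where "r = norm (min_norm_minimizer f)"
  define a where "a = 1 + 3 * (\<beta> + 1)"
  define U where "U = 3 * (\<beta> + 1) * (1 + 1 / a + r)"
  define \<tau> where "\<tau> = U / (1 + U)"
  define Q where "Q = a * \<epsilon> / (mu 0 * ((3 * \<beta> + 4) * r + 2))"
  have a: "0 < a" and a_alt: "3 * \<beta> + 4 = a"
    using beta_pos by (auto simp: a_def)
  have r0: "0 \<le> r" by (simp add: r_def)
  have "0 < 3 * (\<beta> + 1)" "0 < 1 + 1 / a + r"
    using beta_pos r0 a by (auto intro!: add_pos_nonneg)
  then have U: "0 < U"
    unfolding U_def by (rule mult_pos_pos)
  then have \<tau>: "0 < \<tau>" "\<tau> < 1"
    by (simp_all add: \<tau>_def)
  have "0 < a * r + 2"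
    using a r0 by (simp add: add_nonneg_pos)
  then have den: "0 < mu 0 * (a * r + 2)"
    using mu_pos[of 0] by simp
  then have Q: "0 < Q"
    using a \<open>0 < \<epsilon>\<close> by (simp add: Q_def a_alt)
  have "continuous_on UNIV f"
    using differentiable by (simp add: continuous_at_imp_continuous_on differentiable_imp_continuous_within)
  then have "is_arg_min f (\<lambda>_. True) (min_norm_minimizer f)"
    using assms(3) by (rule min_norm_minimizer_is_minimizer)
  then have zero: "gradient f (min_norm_minimizer f) = 0"
    by (rule gradient_zero_at_minimizer[OF differentiable])
  have shrink: "shrink_factor \<beta> (outer_start (Suc k)) \<le> \<tau>" for k
    using shrink_factor_mono[OF beta_pos norm_outer_start_le[OF zero, of k]]
    by (simp add: \<tau>_def U_def a_def r_def add_ac)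
  \<comment> \<open>For \<open>Q \<ge> 1\<close> the logarithm is not positive and \<open>K = 0\<close>: the first output is good enough.\<close>
  define K where "K = nat \<lceil>log \<tau> Q\<rceil>"
  have "\<tau> ^ K \<le> Q"
  proof -
    have "log \<tau> Q \<le> real K"
      unfolding K_def by linarith
    then have "\<tau> powr real K \<le> \<tau> powr log \<tau> Q"
      using \<tau> by (intro powr_mono') auto
    then show ?thesis
      using \<tau> Q by (simp add: powr_realpow)
  qed
  have small: "norm (gradient f (hsodm_output S f \<beta> K)) \<le> \<epsilon>"
  proof -
    have "norm (gradient f (hsodm_output S f \<beta> K)) \<le> mu K * (r + 2 / a)"
      using gradient_output_le[OF zero, of K] by (simp add: r_def a_def)
    also have "\<dots> \<le> (Q * mu 0) * (r + 2 / a)"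
    proof (rule mult_right_mono)
      have "mu K \<le> \<tau> ^ K * mu 0"
        by (rule mu_geometric[OF shrink])
      also have "\<dots> \<le> Q * mu 0"
        using \<open>\<tau> ^ K \<le> Q\<close> mu_pos[of 0] by (intro mult_right_mono) auto
      finally show "mu K \<le> Q * mu 0" .
    qed (use r0 a in simp)
    also have "\<dots> = Q * (mu 0 * (a * r + 2)) / a"
      using a by (simp add: field_simps)
    also have "\<dots> = \<epsilon>"
    proof -
      have "a * \<epsilon> / W * W / a = \<epsilon>" if "0 < W" for W
        using that a by simp
      from this[OF den] show ?thesis
        unfolding Q_def a_alt .
    qed
    finally show ?thesis .
  qed
  have "hsodm_models_needed S f \<beta> \<epsilon> \<le> (LEAST K. norm (gradient f (hsodm_output S f \<beta> K)) \<le> \<epsilon>)"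
    unfolding hsodm_models_needed_def by (rule models_le)
  also have "\<dots> \<le> K"
    using small by (rule Least_le)
  also have "K \<le> nat \<lceil>2 * log \<tau> Q\<rceil>"
    unfolding K_def by linarith
  finally have "hsodm_models_needed S f \<beta> \<epsilon> \<le> nat \<lceil>2 * log \<tau> Q\<rceil>" .
  then show ?thesis
    using \<tau> well_defined small
    unfolding Let_def \<tau>_def U_def Q_def a_def r_def mu_0 by auto
qed

end
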